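(* Let $\{e_1,\dots,e_n\}$ be a family of orthonormal vectors in the complex Hilbert space $(H;\langle\cdot,\cdot\rangle)$. Suppose $k_j,h_j\ge 0$, $j\in\{1,\dots,n\}$, and $f\in L([a,b];H)$ are such that $$k_j\|f(t)\|\le \operatorname{Re}\langle f(t),e_j\rangle,\qquad h_j\|f(t)\|\le \operatorname{Im}\langle f(t),e_j\rangle$$ for each $j\in\{1,\dots,n\}$ and a.e. $t\in[a,b]$. Then $$\left[\sum_{j=1}^n\left(k_j^2+h_j^2\right)\right]^{\frac12}\int_a^b\|f(t)\|\,dt\le\left\|\int_a^b f(t)\,dt\right\|.$$ Equality holds in this inequality if and only if $$\int_a^b f(t)\,dt=\left(\int_a^b\|f(t)\|\,dt\right)\sum_{j=1}^n(k_j+ih_j)e_j.$$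
   Context: $L([a,b];H)$ denotes the set of functions $f:[a,b]\to H$ that are Bochner measurable on $[a,b]$ with $\int_a^b\|f(t)\|\,dt$ finite; integrals of $H$-valued functions are Bochner integrals with respect to Lebesgue measure. The inner product is linear in the first variable and conjugate-linear in the second. $i$ is the imaginary unit. *)

theory Defs
  imports "HOL-Analysis.Analysis"
begin

class complex_vector = real_vector +
  fixes scaleC :: "complex \<Rightarrow> 'a \<Rightarrow> 'a"  (infixr \<open>*\<^sub>C\<close> 75)
  assumes scaleR_scaleC: "r *\<^sub>R x = complex_of_real r *\<^sub>C x"
    and scaleC_add_right: "c *\<^sub>C (x + y) = c *\<^sub>C x + c *\<^sub>C y"
    and scaleC_add_left: "(c + d) *\<^sub>C x = c *\<^sub>C x + d *\<^sub>C x"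
    and scaleC_scaleC: "c *\<^sub>C (d *\<^sub>C x) = (c * d) *\<^sub>C x"
    and scaleC_one: "1 *\<^sub>C x = x"

text \<open>The inner product is linear in the first argument and conjugate-linear in the second.\<close>

class complex_inner = complex_vector + real_normed_vector +
  fixes cinner :: "'a \<Rightarrow> 'a \<Rightarrow> complex"
  assumes cinner_commute: "cinner x y = cnj (cinner y x)"
    and cinner_add_left: "cinner (x + y) z = cinner x z + cinner y z"
    and cinner_scaleC_left: "cinner (c *\<^sub>C x) y = c * cinner x y"
    and cinner_ge_zero: "0 \<le> Re (cinner x x)"
    and cinner_eq_zero_iff: "cinner x x = 0 \<longleftrightarrow> x = 0"
    and norm_eq_sqrt_cinner: "norm x = sqrt (Re (cinner x x))"

class complex_hilbert_space = complex_inner + banach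

instantiation complex :: complex_hilbert_space
begin

definition scaleC_complex :: "complex \<Rightarrow> complex \<Rightarrow> complex"
  where "scaleC_complex c x = c * x"

definition cinner_complex :: "complex \<Rightarrow> complex \<Rightarrow> complex"
  where "cinner_complex x y = x * cnj y"

instance
  by intro_classes
    (auto simp: scaleC_complex_def cinner_complex_def scaleR_conv_of_real algebra_simps
      cmod_def power2_eq_square)

end

text \<open>
  The library's \<^const>\<open>has_bochner_integral\<close>, \<^const>\<open>integrable\<close> and \<^const>\<open>lebesgue_integral\<close>
  are restricted to second-countable codomains, that is, to separable Hilbert spaces. The versions
  below follow the same construction for arbitrary normed spaces; Borel measurability is replaced
  by a.e. approximability by simple functions.
\<close>

definition bochner_measurable :: "'m measure \<Rightarrow> ('m \<Rightarrow> 'b::real_normed_vector) \<Rightarrow> bool"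
  where "bochner_measurable M f \<longleftrightarrow>
    (\<exists>s. (\<forall>i::nat. simple_function M (s i)) \<and> (AE x in M. (\<lambda>i. s i x) \<longlonglongrightarrow> f x))"

definition has_strong_integral ::
    "'m measure \<Rightarrow> ('m \<Rightarrow> 'b::real_normed_vector) \<Rightarrow> 'b \<Rightarrow> bool"
  where "has_strong_integral M f I \<longleftrightarrow> bochner_measurable M f \<and>
    (\<exists>s. (\<forall>i::nat. Bochner_Integration.simple_bochner_integrable M (s i)) \<and>
         (\<lambda>i. \<integral>\<^sup>+x. ennreal (norm (f x - s i x)) \<partial>M) \<longlonglongrightarrow> 0 \<and>
         (\<lambda>i. Bochner_Integration.simple_bochner_integral M (s i)) \<longlonglongrightarrow> I)"

definition strong_integral :: "'m measure \<Rightarrow> ('m \<Rightarrow> 'b::real_normed_vector) \<Rightarrow> 'b"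
  where "strong_integral M f =
    (if \<exists>I. has_strong_integral M f I then THE I. has_strong_integral M f I else 0)"

lemma has_bochner_integral_imp_has_strong_integral:
  fixes f :: "'m \<Rightarrow> 'b::{real_normed_vector, second_countable_topology}"
  assumes "has_bochner_integral M f I"
  shows "has_strong_integral M f I"
  using assms
proof cases
  case (1 s)
  obtain u where "\<And>i. simple_function M (u i)" "\<And>x. x \<in> space M \<Longrightarrow> (\<lambda>i. u i x) \<longlonglongrightarrow> f x"
    using borel_measurable_implies_sequence_metric[OF 1(1), of 0] by blast
  then have "bochner_measurable M f"
    unfolding bochner_measurable_def by (intro exI[of _ u]) auto
  with 1 show ?thesis
    unfolding has_strong_integral_def by blast
qed

definition bochner_L :: "real \<Rightarrow> real \<Rightarrow> (real \<Rightarrow> 'b::real_normed_vector) set"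
  where "bochner_L a b = {f. bochner_measurable (lebesgue_on {a..b}) f \<and>
    integrable (lebesgue_on {a..b}) (\<lambda>t. norm (f t))}"

end

theory Submission
  imports Defs
begin

text \<open>
  Put \<open>w = (\<Sum>j. (k\<^sub>j + \<i> h\<^sub>j) e\<^sub>j)\<close>, \<open>S = norm w ^ 2\<close>, \<open>I\<close> the integral of \<open>f\<close> and \<open>J\<close> the integral of
  \<open>norm f\<close>. The hypotheses give \<open>S * norm (f t) \<le> Re \<langle>f t, w\<rangle>\<close> almost everywhere, hence
  \<open>S * J \<le> Re \<langle>I, w\<rangle>\<close>, and expanding the square yields
  \<open>norm (I - J w) ^ 2 \<le> norm I ^ 2 - S * J ^ 2\<close>. This single estimate contains both the inequality
  and the equality case.
\<close>

section \<open>Strong integrals over complete measures\<close>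

text \<open>A null set of the restriction is a Lebesgue null set inside \<open>S\<close>, and
  Lebesgue measure is itself a completion. Completeness is what makes almost-everywhere limits of
  simple functions measurable below.\<close>

lemma complete_measure_lebesgue_on:
  assumes "S \<in> sets lebesgue"
  shows "complete_measure (lebesgue_on S)"
proof
  fix A B :: "'a set"
  assume "B \<subseteq> A" "A \<in> null_sets (lebesgue_on S)"
  then have "A \<in> null_sets lebesgue" "A \<subseteq> S"
    using assms by (auto simp: null_sets_restrict_space)
  with \<open>B \<subseteq> A\<close> have "B \<in> sets lebesgue" "B \<subseteq> S"
    using completion.complete by blast+
  then show "B \<in> sets (lebesgue_on S)"
    using assms by (simp add: sets_restrict_space_iff)
qed

text \<open>The preimages of a Borel set under \<open>f\<close> and \<open>g\<close> differ only by
  a subset of a null set, which is measurable by completeness.\<close>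

lemma (in complete_measure) borel_measurable_cong_AE:
  assumes g: "g \<in> borel_measurable M" and eq: "AE x in M. g x = f x"
  shows "f \<in> borel_measurable M"
proof (rule measurableI)
  fix A :: "'b set" assume "A \<in> sets borel"
  with g have meas: "g -` A \<inter> space M \<in> sets M"
    by (rule measurable_sets)
  have "AE x in M. x \<in> g -` A \<inter> space M \<longleftrightarrow> x \<in> f -` A \<inter> space M"
    using eq by eventually_elim auto
  then show "f -` A \<inter> space M \<in> sets M"
    by (rule in_sets_AE[OF _ meas]) simp
qed simp

text \<open>Setting \<open>f\<close> and its approximants to 0 on the exceptional null set gives
  convergence everywhere. Pointwise limits of measurable functions into a metric space are Borel,
  with or without separability, and completeness allows the return to \<open>f\<close>.\<close>

lemma (in complete_measure) bochner_measurable_imp_borel_measurable: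
  fixes f :: "'a \<Rightarrow> 'b::real_normed_vector"
  assumes "bochner_measurable M f"
  shows "f \<in> borel_measurable M"
proof -
  obtain s where s: "\<And>i. simple_function M (s i)" "AE x in M. (\<lambda>i. s i x) \<longlonglongrightarrow> f x"
    using assms unfolding bochner_measurable_def by blast
  obtain N where N: "N \<in> null_sets M" "\<And>x. x \<in> space M - N \<Longrightarrow> (\<lambda>i. s i x) \<longlonglongrightarrow> f x"
    using AE_E3[OF s(2)] by blast
  let ?g = "\<lambda>x. if x \<in> N then 0 else f x"
  have "?g \<in> borel_measurable M"
  proof (rule borel_measurable_LIMSEQ_metric[where f = "\<lambda>i x. if x \<in> N then 0 else s i x"])
    have "N \<inter> space M \<in> sets M"
      using N(1) by auto
    then show "(\<lambda>x. if x \<in> N then 0 else s i x) \<in> borel_measurable M" for i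
      by (intro borel_measurable_simple_function simple_function_If_set simple_function_const s(1))
  qed (use N in auto)
  moreover have "AE x in M. ?g x = f x"
    using AE_not_in[OF N(1)] by eventually_elim auto
  ultimately show ?thesis
    by (rule borel_measurable_cong_AE)
qed

lemma bochner_measurable_simple: "simple_function M s \<Longrightarrow> bochner_measurable M s"
  unfolding bochner_measurable_def by (intro exI[of _ "\<lambda>_. s"]) auto

lemma bochner_measurable_diff:
  assumes "bochner_measurable M f" "bochner_measurable M g"
  shows "bochner_measurable M (\<lambda>x. f x - g x)"
proof -
  obtain s t where s: "\<And>i. simple_function M (s i)" "AE x in M. (\<lambda>i. s i x) \<longlonglongrightarrow> f x"
    and t: "\<And>i. simple_function M (t i)" "AE x in M. (\<lambda>i. t i x) \<longlonglongrightarrow> g x"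
    using assms unfolding bochner_measurable_def by blast
  have "AE x in M. (\<lambda>i. s i x - t i x) \<longlonglongrightarrow> f x - g x"
    using s(2) t(2) by eventually_elim (rule tendsto_diff)
  then show ?thesis
    using s(1) t(1) unfolding bochner_measurable_def
    by (intro exI[of _ "\<lambda>i x. s i x - t i x"]) (auto intro: simple_function_compose2)
qed

text \<open>The difference is formed on the simple approximants, since for non-separable codomains
  the difference of two Borel functions need not be Borel.\<close>

lemma (in complete_measure) bochner_measurable_norm_diff_simple:
  assumes "bochner_measurable M f" "simple_function M s"
  shows "(\<lambda>x. norm (f x - s x)) \<in> borel_measurable M"
proof -
  have "(\<lambda>x. f x - s x) \<in> borel_measurable M"
    by (rule bochner_measurable_imp_borel_measurable[OF
      bochner_measurable_diff[OF assms(1) bochner_measurable_simple[OF assms(2)]]])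
  then show ?thesis
    by (rule borel_measurable_continuous_on[OF continuous_on_norm_id])
qed

section \<open>Uniqueness, linear images and existence of the integral\<close>

text \<open>Triangle inequality in L1, passing through \<open>f\<close>. It serves twice: for
  uniqueness of the integral and for the Cauchy property behind its existence.\<close>

lemma (in complete_measure) norm_simple_bochner_integral_diff_le:
  fixes f :: "'a \<Rightarrow> 'b::real_normed_vector"
  assumes f: "bochner_measurable M f"
    and s: "Bochner_Integration.simple_bochner_integrable M s"
    and t: "Bochner_Integration.simple_bochner_integrable M t"
  shows "ennreal (norm (Bochner_Integration.simple_bochner_integral M s
            - Bochner_Integration.simple_bochner_integral M t))
    \<le> (\<integral>\<^sup>+x. norm (f x - s x) \<partial>M) + (\<integral>\<^sup>+x. norm (f x - t x) \<partial>M)"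
    (is "ennreal (norm (?s - ?t)) \<le> ?S + ?T")
proof -
  have [measurable]: "(\<lambda>x. norm (f x - s x)) \<in> borel_measurable M"
    "(\<lambda>x. norm (f x - t x)) \<in> borel_measurable M"
    using f s t by (auto intro: bochner_measurable_norm_diff_simple
      elim: Bochner_Integration.simple_bochner_integrable.cases)
  have "ennreal (norm (?s - ?t))
      = norm (Bochner_Integration.simple_bochner_integral M (\<lambda>x. s x - t x))"
    using s t by (subst simple_bochner_integral_diff) auto
  also have "\<dots> \<le> Bochner_Integration.simple_bochner_integral M (\<lambda>x. norm (s x - t x))"
    using simple_bochner_integrable_compose2[of "(-)" M s t] s t
    by (auto intro!: ennreal_leI simple_bochner_integral_norm_bound)
  also have "\<dots> = (\<integral>\<^sup>+x. norm (s x - t x) \<partial>M)"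
    using simple_bochner_integrable_compose2[of "\<lambda>x y. norm (x - y)" M s t] s t
    by (auto intro!: simple_bochner_integral_eq_nn_integral)
  also have "\<dots> \<le> (\<integral>\<^sup>+x. ennreal (norm (f x - s x)) + ennreal (norm (f x - t x)) \<partial>M)"
  proof (rule nn_integral_mono)
    fix x
    have "norm (s x - t x) \<le> norm (f x - s x) + norm (f x - t x)"
      by (metis dual_order.refl norm_diff_triangle_le norm_minus_commute)
    then show "ennreal (norm (s x - t x)) \<le> ennreal (norm (f x - s x)) + ennreal (norm (f x - t x))"
      by (simp flip: ennreal_plus)
  qed
  also have "\<dots> = ?S + ?T"
    by (rule nn_integral_add) auto
  finally show ?thesis .
qed

lemma (in complete_measure) has_strong_integral_unique:
  fixes f :: "'a \<Rightarrow> 'b::real_normed_vector"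
  assumes "has_strong_integral M f I" "has_strong_integral M f J"
  shows "I = J"
proof -
  let ?int = "Bochner_Integration.simple_bochner_integral M"
  obtain s where f: "bochner_measurable M f"
    and s: "\<And>i::nat. Bochner_Integration.simple_bochner_integrable M (s i)"
      "(\<lambda>i. \<integral>\<^sup>+x. norm (f x - s i x) \<partial>M) \<longlonglongrightarrow> 0" "(\<lambda>i. ?int (s i)) \<longlonglongrightarrow> I"
    using assms(1) unfolding has_strong_integral_def by blast
  obtain t where t: "\<And>i::nat. Bochner_Integration.simple_bochner_integrable M (t i)"
      "(\<lambda>i. \<integral>\<^sup>+x. norm (f x - t i x) \<partial>M) \<longlonglongrightarrow> 0" "(\<lambda>i. ?int (t i)) \<longlonglongrightarrow> J"
    using assms(2) unfolding has_strong_integral_def by blast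
  have "(\<lambda>i. ennreal (norm (?int (s i) - ?int (t i)))) \<longlonglongrightarrow> 0"
  proof (rule tendsto_sandwich[where f = "\<lambda>_. 0"])
    show "(\<lambda>i. (\<integral>\<^sup>+x. norm (f x - s i x) \<partial>M) + (\<integral>\<^sup>+x. norm (f x - t i x) \<partial>M)) \<longlonglongrightarrow> 0"
      using tendsto_add[OF s(2) t(2)] by simp
  qed (use norm_simple_bochner_integral_diff_le[OF f s(1) t(1)] in auto)
  moreover have "(\<lambda>i. ennreal (norm (?int (s i) - ?int (t i)))) \<longlonglongrightarrow> ennreal (norm (I - J))"
    by (intro tendsto_ennrealI tendsto_norm tendsto_diff s t)
  ultimately have "ennreal (norm (I - J)) = 0"
    using LIMSEQ_unique by blast
  then show ?thesis
    by simp
qed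

lemma (in complete_measure) strong_integral_eqI:
  "has_strong_integral M f I \<Longrightarrow> strong_integral M f = I"
  unfolding strong_integral_def using has_strong_integral_unique
  by (metis (mono_tags, lifting) theI)

text \<open>Composing the approximants with \<open>T\<close> enlarges their L1 error by at most the
  factor \<open>K\<close>. With a scalar-valued \<open>T\<close> this leads from the strong integral
  to the ordinary one, where monotonicity is available.\<close>

lemma (in complete_measure) has_strong_integral_bounded_linear:
  fixes T :: "'b::real_normed_vector \<Rightarrow> 'c::{real_normed_vector, second_countable_topology}"
  assumes T: "bounded_linear T" and I: "has_strong_integral M f I"
  shows "has_bochner_integral M (\<lambda>x. T (f x)) (T I)"
proof -
  interpret T: bounded_linear T by fact
  obtain s where f: "bochner_measurable M f"
    and s: "\<And>i::nat. Bochner_Integration.simple_bochner_integrable M (s i)"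
      "(\<lambda>i. \<integral>\<^sup>+x. norm (f x - s i x) \<partial>M) \<longlonglongrightarrow> 0"
      "(\<lambda>i. Bochner_Integration.simple_bochner_integral M (s i)) \<longlonglongrightarrow> I"
    using I unfolding has_strong_integral_def by blast
  have [measurable]: "(\<lambda>x. norm (f x - s i x)) \<in> borel_measurable M" for i
    using f s(1)[of i] by (auto intro: bochner_measurable_norm_diff_simple
      elim: Bochner_Integration.simple_bochner_integrable.cases)
  obtain K where K: "K > 0" "\<And>x i. norm (T (f x) - T (s i x)) \<le> norm (f x - s i x) * K"
    using T.pos_bounded by (auto simp: T.diff[symmetric])
  show ?thesis
  proof (rule has_bochner_integral.intros)
    show "(\<lambda>x. T (f x)) \<in> borel_measurable M"
      using bochner_measurable_imp_borel_measurable[OF f]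
      by (rule borel_measurable_continuous_on[OF T.continuous_on[OF continuous_on_id]])
    show "Bochner_Integration.simple_bochner_integrable M (\<lambda>x. T (s i x))" for i
      using s(1)[of i] by (auto intro: simple_bochner_integrable_compose2 T.zero)
    show "(\<lambda>i. \<integral>\<^sup>+x. norm (T (f x) - T (s i x)) \<partial>M) \<longlonglongrightarrow> 0"
    proof (rule tendsto_sandwich[where f = "\<lambda>_. 0"])
      have "(\<integral>\<^sup>+x. norm (T (f x) - T (s i x)) \<partial>M) \<le> K * (\<integral>\<^sup>+x. norm (f x - s i x) \<partial>M)" for i
      proof -
        have "(\<integral>\<^sup>+x. norm (T (f x) - T (s i x)) \<partial>M)
            \<le> (\<integral>\<^sup>+x. ennreal K * norm (f x - s i x) \<partial>M)"
          using K by (intro nn_integral_mono) (auto simp: ac_simps ennreal_mult[symmetric])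
        also have "\<dots> = K * (\<integral>\<^sup>+x. norm (f x - s i x) \<partial>M)"
          by (intro nn_integral_cmult) auto
        finally show ?thesis .
      qed
      then show "\<forall>\<^sub>F i in sequentially.
          (\<integral>\<^sup>+x. norm (T (f x) - T (s i x)) \<partial>M) \<le> K * (\<integral>\<^sup>+x. norm (f x - s i x) \<partial>M)"
        by simp
      show "(\<lambda>i. K * (\<integral>\<^sup>+x. norm (f x - s i x) \<partial>M)) \<longlonglongrightarrow> 0"
        using ennreal_tendsto_cmult[OF _ s(2)] by simp
    qed auto
    show "(\<lambda>i. Bochner_Integration.simple_bochner_integral M (\<lambda>x. T (s i x))) \<longlonglongrightarrow> T I"
      using s by (auto intro!: T.tendsto simp: simple_bochner_integral_linear T.linear_axioms)
  qed
qed

text \<open>Dominated convergence turns almost-everywhere approximation into L1 approximation. The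
  integrals of the approximants are then Cauchy, and completeness of the codomain supplies the
  limit.\<close>

lemma (in complete_measure) has_strong_integral_strong_integral:
  fixes f :: "'a \<Rightarrow> 'b::banach"
  assumes f: "bochner_measurable M f" and int: "integrable M (\<lambda>x. norm (f x))"
  shows "has_strong_integral M f (strong_integral M f)"
proof -
  let ?int = "Bochner_Integration.simple_bochner_integral M"
  obtain s where s: "\<And>i. simple_function M (s i)" "AE x in M. (\<lambda>i. s i x) \<longlonglongrightarrow> f x"
    using f unfolding bochner_measurable_def by blast
  have [measurable]: "(\<lambda>x. norm (f x)) \<in> borel_measurable M"
    using int by simp
  have [measurable]: "s i \<in> borel_measurable M" for i
    using s(1) by (rule borel_measurable_simple_function)
  \<comment> \<open>Truncating the approximants at twice the norm of \<open>f\<close> makes them dominated without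
    destroying pointwise convergence.\<close>
  define t where "t i x = (if norm (s i x) \<le> 2 * norm (f x) then s i x else 0)" for i x
  have simple: "simple_function M (t i)" for i
    unfolding t_def using s(1) by (intro simple_function_If) auto
  have t_le: "norm (t i x) \<le> 2 * norm (f x)" for i x
    by (simp add: t_def)
  have t_lim: "AE x in M. (\<lambda>i. t i x) \<longlonglongrightarrow> f x"
    using s(2)
  proof eventually_elim
    fix x assume lim: "(\<lambda>i. s i x) \<longlonglongrightarrow> f x"
    \<comment> \<open>If \<open>f x = 0\<close>, truncation forces every \<open>t i x\<close> to be
      0. Otherwise \<open>norm (s i x)\<close> tends to \<open>norm (f x)\<close>, strictly below
      the threshold, so truncation eventually changes nothing.\<close>
    show "(\<lambda>i. t i x) \<longlonglongrightarrow> f x"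
    proof (cases "f x = 0")
      case True
      then show ?thesis
        by (simp add: t_def cong: if_cong)
    next
      case False
      have "\<forall>\<^sub>F i in sequentially. norm (s i x) < 2 * norm (f x)"
        using False by (intro order_tendstoD(2)[OF tendsto_norm[OF lim]]) simp
      then have "\<forall>\<^sub>F i in sequentially. s i x = t i x"
        by eventually_elim (simp add: t_def)
      with lim show ?thesis
        by (rule Lim_transform_eventually)
    qed
  qed
  have bound_finite: "(\<integral>\<^sup>+x. ennreal (c * norm (f x)) \<partial>M) < \<infinity>" if "c \<ge> 0" for c
  proof -
    have "integrable M (\<lambda>x. c * norm (f x))"
      using int by simp
    from integrable_iff_bounded[THEN iffD1, OF this] show ?thesis
      using that by (simp add: abs_mult)
  qed
  have sbi: "Bochner_Integration.simple_bochner_integrable M (t i)" for i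
  proof (rule simple_bochner_integrableI_bounded[OF simple])
    have "(\<integral>\<^sup>+x. norm (t i x) \<partial>M) \<le> (\<integral>\<^sup>+x. ennreal (2 * norm (f x)) \<partial>M)"
      by (intro nn_integral_mono ennreal_leI t_le)
    also have "\<dots> < \<infinity>"
      by (rule bound_finite) simp
    finally show "(\<integral>\<^sup>+x. norm (t i x) \<partial>M) < \<infinity>" .
  qed
  have conv: "(\<lambda>i. \<integral>\<^sup>+x. norm (f x - t i x) \<partial>M) \<longlonglongrightarrow> 0"
  proof -
    have "(\<lambda>i. \<integral>\<^sup>+x. norm (f x - t i x) \<partial>M) \<longlonglongrightarrow> (\<integral>\<^sup>+x. 0 \<partial>M)"
    proof (rule nn_integral_dominated_convergence)
      show "(\<lambda>x. ennreal (norm (f x - t i x))) \<in> borel_measurable M" for i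
        using bochner_measurable_norm_diff_simple[OF f simple[of i]] by measurable
      \<comment> \<open>The factor 3 is 1 for \<open>f\<close> plus 2 for the truncation
        bound.\<close>
      have "norm (f x - t i x) \<le> 3 * norm (f x)" for i x
        using norm_triangle_ineq4[of "f x" "t i x"] t_le[of i x] by linarith
      then show "AE x in M. ennreal (norm (f x - t i x)) \<le> ennreal (3 * norm (f x))" for i
        by (auto intro!: ennreal_leI)
      show "(\<integral>\<^sup>+x. ennreal (3 * norm (f x)) \<partial>M) < \<infinity>"
        by (rule bound_finite) simp
      show "AE x in M. (\<lambda>i. ennreal (norm (f x - t i x))) \<longlonglongrightarrow> 0"
        using t_lim
      proof eventually_elim
        fix x assume "(\<lambda>i. t i x) \<longlonglongrightarrow> f x"
        from tendsto_diff[OF tendsto_const[of "f x"] this]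
        show "(\<lambda>i. ennreal (norm (f x - t i x))) \<longlonglongrightarrow> 0"
          by (simp add: tendsto_norm_zero_iff flip: ennreal_0)
      qed
    qed auto
    then show ?thesis
      by simp
  qed
  have "Cauchy (\<lambda>i. ?int (t i))"
  proof (rule metric_CauchyI)
    fix e :: real assume "e > 0"
    then have "\<forall>\<^sub>F i in sequentially. (\<integral>\<^sup>+x. norm (f x - t i x) \<partial>M) < ennreal (e / 2)"
      by (intro order_tendstoD(2)[OF conv]) simp
    then obtain N where N: "\<And>i. i \<ge> N \<Longrightarrow> (\<integral>\<^sup>+x. norm (f x - t i x) \<partial>M) < ennreal (e / 2)"
      unfolding eventually_sequentially by blast
    have "dist (?int (t m)) (?int (t n)) < e" if "m \<ge> N" "n \<ge> N" for m n
    proof -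
      have "ennreal (norm (?int (t m) - ?int (t n)))
          \<le> (\<integral>\<^sup>+x. norm (f x - t m x) \<partial>M) + (\<integral>\<^sup>+x. norm (f x - t n x) \<partial>M)"
        by (rule norm_simple_bochner_integral_diff_le[OF f sbi sbi])
      also have "\<dots> < ennreal (e / 2) + ennreal (e / 2)"
        by (intro add_strict_mono N that)
      also have "\<dots> = ennreal e"
        using \<open>e > 0\<close> by (simp flip: ennreal_plus)
      finally show ?thesis
        by (simp add: dist_norm ennreal_less_iff)
    qed
    then show "\<exists>N. \<forall>m\<ge>N. \<forall>n\<ge>N. dist (?int (t m)) (?int (t n)) < e"
      by blast
  qed
  then obtain I where "(\<lambda>i. ?int (t i)) \<longlonglongrightarrow> I"
    using Cauchy_convergent convergent_def by blast
  with f sbi conv have "has_strong_integral M f I"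
    unfolding has_strong_integral_def by blast
  with strong_integral_eqI[OF this] show ?thesis
    by simp
qed

section \<open>The real part of the inner product\<close>

lemma cinner_add_right: "cinner x (y + z) = cinner x y + cinner x z"
  by (subst (1 2 3) cinner_commute) (simp add: cinner_add_left)

lemma cinner_scaleC_right: "cinner x (c *\<^sub>C y) = cnj c * cinner x y"
  by (subst (1 2) cinner_commute) (simp add: cinner_scaleC_left)

lemma cinner_zero_right [simp]: "cinner x 0 = 0"
  using cinner_add_right[of x 0 0] by simp

lemma cinner_zero_left [simp]: "cinner 0 x = 0"
  using cinner_add_left[of 0 0 x] by simp

lemma cinner_sum_left: "cinner (\<Sum>j\<in>A. g j) x = (\<Sum>j\<in>A. cinner (g j) x)"
  by (induction A rule: infinite_finite_induct) (auto simp: cinner_add_left)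

lemma cinner_sum_right: "cinner x (\<Sum>j\<in>A. g j) = (\<Sum>j\<in>A. cinner x (g j))"
  by (induction A rule: infinite_finite_induct) (auto simp: cinner_add_right)

lemma power2_norm_eq_Re_cinner: "(norm x)\<^sup>2 = Re (cinner x x)"
  by (simp add: norm_eq_sqrt_cinner cinner_ge_zero)

lemma Re_cinner_commute: "Re (cinner x y) = Re (cinner y x)"
  by (subst cinner_commute) simp

lemma Re_cinner_scaleR_left: "Re (cinner (r *\<^sub>R x) y) = r * Re (cinner x y)"
  by (simp add: scaleR_scaleC cinner_scaleC_left)

lemma power2_norm_add: "(norm (x + y))\<^sup>2 = (norm x)\<^sup>2 + 2 * Re (cinner x y) + (norm y)\<^sup>2"
  using Re_cinner_commute[of y x]
  by (simp add: power2_norm_eq_Re_cinner cinner_add_left cinner_add_right)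

lemma power2_norm_diff_scaleR:
  "(norm (x - r *\<^sub>R y))\<^sup>2 = (norm x)\<^sup>2 - 2 * r * Re (cinner x y) + r\<^sup>2 * (norm y)\<^sup>2"
proof -
  have "Re (cinner x (- (r *\<^sub>R y))) = - r * Re (cinner x y)"
    using Re_cinner_scaleR_left[of "- r" y x]
    by (metis Re_cinner_commute scaleR_minus_left)
  then show ?thesis
    using power2_norm_add[of x "- (r *\<^sub>R y)"] by (simp add: power_mult_distrib)
qed

text \<open>The norm being given, Cauchy-Schwarz is the squared triangle inequality.\<close>

lemma Re_cinner_le: "Re (cinner x y) \<le> norm x * norm y"
proof -
  have "(norm (x + y))\<^sup>2 \<le> (norm x + norm y)\<^sup>2"
    by (intro power_mono norm_triangle_ineq) simp
  then show ?thesis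
    by (simp add: power2_norm_add power2_sum)
qed

text \<open>The real part is real-linear, which suffices for exchanging it with the integral. Since
  \<open>Re_cinner_le\<close> is one-sided, the bound on the absolute value takes it at both
  \<open>x\<close> and \<open>- x\<close>.\<close>

lemma bounded_linear_Re_cinner_left: "bounded_linear (\<lambda>x. Re (cinner x y))"
proof (rule bounded_linear_intro[where K = "norm y"])
  fix x
  have "- Re (cinner x y) = Re (cinner (- x) y)"
    using Re_cinner_scaleR_left[of "- 1" x y] by simp
  then show "norm (Re (cinner x y)) \<le> norm x * norm y"
    using Re_cinner_le[of x y] Re_cinner_le[of "- x" y] by simp
qed (auto simp: cinner_add_left Re_cinner_scaleR_left)

text \<open>Pythagoras: orthonormality leaves only the diagonal of the double sum.\<close>

lemma power2_norm_sum_orthonormal: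
  assumes "finite A" and "\<And>i j. i \<in> A \<Longrightarrow> j \<in> A \<Longrightarrow> cinner (e i) (e j) = (if i = j then 1 else 0)"
  shows "(norm (\<Sum>j\<in>A. c j *\<^sub>C e j))\<^sup>2 = (\<Sum>j\<in>A. (cmod (c j))\<^sup>2)"
proof -
  have "cinner (\<Sum>i\<in>A. c i *\<^sub>C e i) (\<Sum>j\<in>A. c j *\<^sub>C e j)
      = (\<Sum>i\<in>A. \<Sum>j\<in>A. if i = j then c i * cnj (c j) else 0)"
    unfolding cinner_sum_left cinner_scaleC_left
    unfolding cinner_sum_right cinner_scaleC_right sum_distrib_left
    using assms(2) by (intro sum.cong) auto
  also have "\<dots> = (\<Sum>i\<in>A. of_real ((cmod (c i))\<^sup>2))"
    using assms(1) by (simp add: sum.delta complex_norm_square del: of_real_power)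
  finally show ?thesis
    by (simp add: power2_norm_eq_Re_cinner)
qed

section \<open>The reverse triangle inequality and its equality case\<close>

theorem theorem3:
  fixes e :: "nat \<Rightarrow> 'a::complex_hilbert_space"
    and n :: nat
    and k h :: "nat \<Rightarrow> real"
    and a b :: real
    and f :: "real \<Rightarrow> 'a"
  assumes "a \<le> b"
    and orthonormal: "\<forall>i\<in>{1..n}. \<forall>j\<in>{1..n}. cinner (e i) (e j) = (if i = j then 1 else 0)"
    and nonneg: "\<forall>j\<in>{1..n}. 0 \<le> k j \<and> 0 \<le> h j"
    and f: "f \<in> bochner_L a b"
    and Re_bound: "\<forall>j\<in>{1..n}. AE t in lebesgue_on {a..b}. k j * norm (f t) \<le> Re (cinner (f t) (e j))"
    and Im_bound: "\<forall>j\<in>{1..n}. AE t in lebesgue_on {a..b}. h j * norm (f t) \<le> Im (cinner (f t) (e j))"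
  shows "sqrt (\<Sum>j=1..n. ((k j)\<^sup>2 + (h j)\<^sup>2)) * (\<integral>t. norm (f t) \<partial>lebesgue_on {a..b})
           \<le> norm (strong_integral (lebesgue_on {a..b}) f)
       \<and> (sqrt (\<Sum>j=1..n. ((k j)\<^sup>2 + (h j)\<^sup>2)) * (\<integral>t. norm (f t) \<partial>lebesgue_on {a..b})
             = norm (strong_integral (lebesgue_on {a..b}) f)
          \<longleftrightarrow> strong_integral (lebesgue_on {a..b}) f
             = (\<integral>t. norm (f t) \<partial>lebesgue_on {a..b}) *\<^sub>R
                 (\<Sum>j=1..n. (complex_of_real (k j) + \<i> * complex_of_real (h j)) *\<^sub>C e j))"
proof -
  let ?M = "lebesgue_on {a..b}"
  define S where "S = (\<Sum>j=1..n. ((k j)\<^sup>2 + (h j)\<^sup>2))"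
  define J where "J = (\<integral>t. norm (f t) \<partial>?M)"
  define I where "I = strong_integral ?M f"
  define w where "w = (\<Sum>j=1..n. (complex_of_real (k j) + \<i> * complex_of_real (h j)) *\<^sub>C e j)"
  interpret complete_measure ?M
    by (rule complete_measure_lebesgue_on) simp
  have int: "integrable ?M (\<lambda>t. norm (f t))" and I: "has_strong_integral ?M f I"
    using f has_strong_integral_strong_integral unfolding bochner_L_def I_def by auto
  have "J \<ge> 0" "S \<ge> 0"
    unfolding J_def S_def by (auto intro!: integral_nonneg_AE sum_nonneg)
  have norm_w: "(norm w)\<^sup>2 = S"
    unfolding w_def S_def
    by (subst power2_norm_sum_orthonormal) (use orthonormal in \<open>auto simp: cmod_power2\<close>)
  \<comment> \<open>Finitely many exceptional null sets are merged into one.\<close>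
  have "AE t in ?M. \<forall>j\<in>{1..n}. k j * norm (f t) \<le> Re (cinner (f t) (e j))
      \<and> h j * norm (f t) \<le> Im (cinner (f t) (e j))"
    using Re_bound Im_bound by (intro AE_finite_allI) auto
  then have "AE t in ?M. S * norm (f t) \<le> Re (cinner (f t) w)"
  proof eventually_elim
    fix t
    assume t: "\<forall>j\<in>{1..n}. k j * norm (f t) \<le> Re (cinner (f t) (e j))
      \<and> h j * norm (f t) \<le> Im (cinner (f t) (e j))"
    \<comment> \<open>One factor of each square stays outside as a nonnegative weight, so that the
      two hypotheses can be multiplied by \<open>k j\<close> and \<open>h j\<close>.\<close>
    have "S * norm (f t) = (\<Sum>j=1..n. k j * (k j * norm (f t)) + h j * (h j * norm (f t)))"
      unfolding S_def sum_distrib_right by (simp add: power2_eq_square algebra_simps)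
    also have "\<dots> \<le> (\<Sum>j=1..n. k j * Re (cinner (f t) (e j)) + h j * Im (cinner (f t) (e j)))"
      using t nonneg by (intro sum_mono add_mono mult_left_mono) auto
    \<comment> \<open>Conjugate-linearity in the second argument turns the coefficient into
      \<open>k j - \<i> * h j\<close>, and the real part of its product with \<open>z\<close> is
      \<open>k j * Re z + h j * Im z\<close>.\<close>
    also have "\<dots> = Re (cinner (f t) w)"
      by (simp add: w_def cinner_sum_right cinner_scaleC_right)
    finally show "S * norm (f t) \<le> Re (cinner (f t) w)" .
  qed
  moreover have "has_bochner_integral ?M (\<lambda>t. Re (cinner (f t) w)) (Re (cinner I w))"
    by (rule has_strong_integral_bounded_linear[OF bounded_linear_Re_cinner_left I])
  ultimately have "S * J \<le> Re (cinner I w)"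
    using integral_mono_AE[of ?M "\<lambda>t. S * norm (f t)" "\<lambda>t. Re (cinner (f t) w)"] int
    by (simp add: J_def has_bochner_integral_iff)
  \<comment> \<open>The factor \<open>2 * J\<close> matches the cross term in the expansion of
    \<open>(norm (I - J *\<^sub>R w))\<^sup>2\<close>; together with the last term
    \<open>J\<^sup>2 * S\<close> it leaves \<open>- S * J\<^sup>2\<close>.\<close>
  then have "2 * J * (S * J) \<le> 2 * J * Re (cinner I w)"
    using \<open>J \<ge> 0\<close> by (intro mult_left_mono) auto
  then have key: "(norm (I - J *\<^sub>R w))\<^sup>2 \<le> (norm I)\<^sup>2 - (sqrt S * J)\<^sup>2"
    using \<open>S \<ge> 0\<close> unfolding power2_norm_diff_scaleR norm_w
    by (simp add: power_mult_distrib power2_eq_square algebra_simps)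
  have "(sqrt S * J)\<^sup>2 \<le> (norm I)\<^sup>2"
    using key zero_le_power2[of "norm (I - J *\<^sub>R w)"] by linarith
  then have "sqrt S * J \<le> norm I"
    by (rule power2_le_imp_le) simp
  \<comment> \<open>Equality makes the right side of \<open>key\<close> vanish, so the square on its
    left is 0.\<close>
  moreover have "I = J *\<^sub>R w" if "sqrt S * J = norm I"
    using key that by simp
  \<comment> \<open>Conversely, \<open>norm (J *\<^sub>R w)\<close> is \<open>J * norm w\<close>
    because \<open>J \<ge> 0\<close>, and \<open>norm w\<close> is \<open>sqrt S\<close>.\<close>
  moreover have "sqrt S * J = norm I" if "I = J *\<^sub>R w"
    using that \<open>J \<ge> 0\<close> by (simp flip: norm_w)
  ultimately show ?thesis
    unfolding S_def[symmetric] J_def[symmetric] I_def[symmetric] w_def[symmetric] by blast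
qed

end
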